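(* Let $X$ be a Tychonoff space and let $XI$ be its Alexandroff Noodles. Then $Hom_p(XI)$ is a topological group (with composition as the group operation).
   Context: For a space $Z$, $Hom(Z)$ is the group, under composition, of all homeomorphisms of $Z$ onto itself, and $Hom_p(Z)$ is the set $Hom(Z)$ with the topology of point-wise convergence, whose basic open sets are $\{h\in Hom(Z): h(z_i)\in O_i,\ i=1,\dots,n\}$ with $z_1,\dots,z_n\in Z$ and $O_1,\dots,O_n$ open in $Z$. Alexandroff Noodles: given a space $X$, let $D=\{d_x:x\in X\}$ be a discrete space indexed bijectively by the elements of $X$. Then $XI$ is the quotient space of the topological disjoint sum $X\cup (D\times[0,1])$ (with $[0,1]$ carrying the usual topology) by the partition whose only non-trivial elements are $\{x,\langle d_x,0\rangle\}$, $x\in X$ (that is, $x$ is identified with $\langle d_x,0\rangle$ for every $x\in X$). *)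

theory Defs
  imports "HOL-Analysis.Analysis" "HOL-Algebra.Bij" "HOL-Library.Disjoint_Sets"
begin

section \<open>Tychonoff spaces\<close>

text \<open>The library's \<^const>\<open>completely_regular_space\<close> does not include a separation axiom for points.\<close>

definition Tychonoff_space :: "'a topology \<Rightarrow> bool" where
  "Tychonoff_space X \<longleftrightarrow> completely_regular_space X \<and> t1_space X"


section \<open>Binary disjoint sums and quotients by partitions\<close>

text \<open>The library's \<^const>\<open>sum_topology\<close> only adds spaces whose points have the same type.\<close>

definition disjoint_sum :: "'a topology \<Rightarrow> 'b topology \<Rightarrow> ('a + 'b) topology" where
  "disjoint_sum X Y = topology (\<lambda>U. openin X (Inl -` U) \<and> openin Y (Inr -` U))"

lemma openin_disjoint_sum:
  "openin (disjoint_sum X Y) U \<longleftrightarrow> openin X (Inl -` U) \<and> openin Y (Inr -` U)"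
proof -
  have "istopology (\<lambda>U. openin X (Inl -` U) \<and> openin Y (Inr -` U))"
    by (auto simp: istopology_def vimage_Union)
  then show ?thesis
    by (simp add: disjoint_sum_def)
qed

lemma topspace_disjoint_sum: "topspace (disjoint_sum X Y) = topspace X <+> topspace Y"
proof
  show "topspace (disjoint_sum X Y) \<subseteq> topspace X <+> topspace Y"
  proof
    fix z assume "z \<in> topspace (disjoint_sum X Y)"
    then obtain U where "z \<in> U" "openin X (Inl -` U)" "openin Y (Inr -` U)"
      by (auto simp: topspace_def openin_disjoint_sum)
    then show "z \<in> topspace X <+> topspace Y"
      by (cases z) (auto dest!: openin_subset)
  qed
  have "Inl -` (topspace X <+> topspace Y) = topspace X"
    "Inr -` (topspace X <+> topspace Y) = topspace Y" by auto
  then show "topspace X <+> topspace Y \<subseteq> topspace (disjoint_sum X Y)"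
    by (intro openin_subset) (simp add: openin_disjoint_sum)
qed

text \<open>The points of the quotient space are the members of the partition \<open>P\<close>.\<close>

definition quotient_space :: "'a topology \<Rightarrow> 'a set set \<Rightarrow> 'a set topology" where
  "quotient_space Z P = topology (\<lambda>\<U>. \<U> \<subseteq> P \<and> openin Z (\<Union>\<U>))"

lemma openin_quotient_space:
  assumes "partition_on (topspace Z) P"
  shows "openin (quotient_space Z P) \<U> \<longleftrightarrow> \<U> \<subseteq> P \<and> openin Z (\<Union>\<U>)"
proof -
  have Int: "\<Union>(\<U> \<inter> \<V>) = \<Union>\<U> \<inter> \<Union>\<V>" if "\<U> \<subseteq> P" "\<V> \<subseteq> P" for \<U> \<V>
  proof
    show "\<Union>\<U> \<inter> \<Union>\<V> \<subseteq> \<Union>(\<U> \<inter> \<V>)"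
    proof
      fix z assume "z \<in> \<Union>\<U> \<inter> \<Union>\<V>"
      then obtain A B where AB: "A \<in> \<U>" "B \<in> \<V>" "z \<in> A" "z \<in> B" by blast
      then have "A = B"
        using that disjointD[OF partition_onD2[OF assms], of A B] by blast
      then show "z \<in> \<Union>(\<U> \<inter> \<V>)" using AB by blast
    qed
  qed blast
  have Un: "\<Union>(\<Union>\<K>) = \<Union>(Union ` \<K>)" for \<K> :: "'a set set set"
    by auto
  have "istopology (\<lambda>\<U>. \<U> \<subseteq> P \<and> openin Z (\<Union>\<U>))"
    unfolding istopology_def
  proof (intro conjI allI impI)
    fix \<U> \<V> assume "\<U> \<subseteq> P \<and> openin Z (\<Union>\<U>)" "\<V> \<subseteq> P \<and> openin Z (\<Union>\<V>)"
    then show "\<U> \<inter> \<V> \<subseteq> P" "openin Z (\<Union>(\<U> \<inter> \<V>))"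
      by (blast, simp add: Int openin_Int)
  next
    fix \<K> assume \<K>: "\<forall>K\<in>\<K>. K \<subseteq> P \<and> openin Z (\<Union>K)"
    then show "\<Union>\<K> \<subseteq> P" by blast
    show "openin Z (\<Union>(\<Union>\<K>))"
      unfolding Un using \<K> by (intro openin_Union) auto
  qed
  then show ?thesis
    by (simp add: quotient_space_def)
qed

lemma topspace_quotient_space:
  assumes "partition_on (topspace Z) P"
  shows "topspace (quotient_space Z P) = P"
proof
  show "topspace (quotient_space Z P) \<subseteq> P"
    using openin_topspace openin_quotient_space[OF assms] by blast
  show "P \<subseteq> topspace (quotient_space Z P)"
    by (intro openin_subset) (simp add: openin_quotient_space[OF assms] flip: partition_onD1[OF assms])
qed


section \<open>Alexandroff noodles\<close>

text \<open>The discrete space \<open>D = {d\<^sub>x. x \<in> X}\<close> is the set \<open>X\<close> itself with the discrete topology, and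
  \<open>d\<^sub>x = x\<close>; the copies of \<open>X\<close> and of \<open>D \<times> [0,1]\<close> are kept apart by the disjoint sum.\<close>

definition noodle_sum :: "'a topology \<Rightarrow> ('a + 'a \<times> real) topology" where
  "noodle_sum X =
     disjoint_sum X (prod_topology (discrete_topology (topspace X)) (top_of_set {0..1}))"

definition noodle_gluings :: "'a topology \<Rightarrow> ('a + 'a \<times> real) set set" where
  "noodle_gluings X = {{Inl x, Inr (x, 0)} | x. x \<in> topspace X}"

definition noodle_partition :: "'a topology \<Rightarrow> ('a + 'a \<times> real) set set" where
  "noodle_partition X =
     noodle_gluings X \<union> {{p} | p. p \<in> topspace (noodle_sum X) - \<Union>(noodle_gluings X)}"

definition Alexandroff_noodles :: "'a topology \<Rightarrow> ('a + 'a \<times> real) set topology" where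
  "Alexandroff_noodles X = quotient_space (noodle_sum X) (noodle_partition X)"

lemma partition_on_noodle_partition:
  "partition_on (topspace (noodle_sum X)) (noodle_partition X)"
proof -
  have "\<Union>(noodle_gluings X) \<subseteq> topspace (noodle_sum X)"
    by (auto simp: noodle_gluings_def noodle_sum_def topspace_disjoint_sum)
  then have "\<Union>(noodle_partition X) = topspace (noodle_sum X)"
    unfolding noodle_partition_def by blast
  moreover have "a \<inter> b = {}"
    if "a \<in> noodle_partition X" "b \<in> noodle_partition X" "a \<noteq> b" for a b
  proof -
    have "g \<inter> h = {}" if "g \<in> noodle_gluings X" "h \<in> noodle_gluings X" "g \<noteq> h" for g h
      using that unfolding noodle_gluings_def by force
    then show ?thesis
      using that unfolding noodle_partition_def by blast
  qed
  moreover have "{} \<notin> noodle_partition X"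
    unfolding noodle_partition_def noodle_gluings_def by blast
  ultimately show ?thesis
    by (simp add: partition_on_def disjoint_def)
qed


section \<open>Homeomorphism groups and the topology of pointwise convergence\<close>

text \<open>As in \<^const>\<open>Bij\<close>, maps are taken extensional, so that each homeomorphism of \<open>Z\<close>
  is represented by exactly one element.\<close>

definition Homeo :: "'a topology \<Rightarrow> ('a \<Rightarrow> 'a) set" where
  "Homeo Z = {h \<in> extensional (topspace Z). homeomorphic_map Z Z h}"

definition Homeo_group :: "'a topology \<Rightarrow> ('a \<Rightarrow> 'a) monoid" where
  "Homeo_group Z = BijGroup (topspace Z) \<lparr>carrier := Homeo Z\<rparr>"

text \<open>A basic open set is given by a finite set \<open>C\<close> of constraints \<open>(z\<^sub>i, O\<^sub>i)\<close>.\<close>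

definition pointwise_basic :: "'a topology \<Rightarrow> ('a \<times> 'a set) set \<Rightarrow> ('a \<Rightarrow> 'a) set" where
  "pointwise_basic Z C = {h \<in> Homeo Z. \<forall>(z, V) \<in> C. h z \<in> V}"

definition Homeo_pointwise :: "'a topology \<Rightarrow> ('a \<Rightarrow> 'a) topology" where
  "Homeo_pointwise Z = topology_generated_by
     {pointwise_basic Z C | C. finite C \<and> C \<subseteq> topspace Z \<times> {V. openin Z V}}"


section \<open>Topological groups\<close>

definition topological_group :: "('a, 'b) monoid_scheme \<Rightarrow> 'a topology \<Rightarrow> bool" where
  "topological_group G T \<longleftrightarrow>
     group G \<and> topspace T = carrier G \<and>
     continuous_map (prod_topology T T) T (\<lambda>(x, y). x \<otimes>\<^bsub>G\<^esub> y) \<and>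
     continuous_map T T (\<lambda>x. inv\<^bsub>G\<^esub> x)"

end

theory Submission
  imports Defs
begin

text \<open>Let \<open>L\<close> be the set of points of \<open>XI\<close> with a compact neighbourhood; its complement consists
  of the non-isolated points of \<open>X\<close>. The noodles with the points outside \<open>L\<close> removed are
  connected, open, and partition \<open>L\<close>, so every homeomorphism permutes them, and hence also their closures, the
  noodles. If \<open>f\<close> is pointwise close to \<open>h\<close> at the free end of the noodle of \<open>x\<close>, then \<open>f\<close> and \<open>h\<close> map this
  noodle onto the same noodle; for a non-isolated \<open>x\<close> this forces \<open>f x = h x\<close>. On \<open>L\<close>, a homeomorphism
  restricted to a noodle is an injective continuous function on \<open>[0,1]\<close>, hence monotone, so
  controlling it at the end points of an interval controls it on the whole interval. This gives the two local
  uniformity properties at points of \<open>L\<close> that make composition and inversion continuous.\<close>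

section \<open>Homeomorphism groups with the pointwise topology\<close>

lemma HomeoI:
  "h \<in> extensional (topspace Z) \<Longrightarrow> homeomorphic_map Z Z h \<Longrightarrow> h \<in> Homeo Z"
  by (simp add: Homeo_def)

lemma Homeo_bij_betw:
  assumes "h \<in> Homeo Z"
  shows "bij_betw h (topspace Z) (topspace Z)"
  using assms by (simp add: Homeo_def bij_betw_def homeomorphic_eq_everything_map)

lemma Homeo_in_topspace: "h \<in> Homeo Z \<Longrightarrow> z \<in> topspace Z \<Longrightarrow> h z \<in> topspace Z"
  using Homeo_bij_betw bij_betwE by blast

lemma Homeo_subset_Bij: "Homeo Z \<subseteq> Bij (topspace Z)"
  using Homeo_bij_betw by (auto simp: Bij_def Homeo_def)

lemma Homeo_compose:
  assumes "g \<in> Homeo Z" "h \<in> Homeo Z"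
  shows "compose (topspace Z) g h \<in> Homeo Z"
proof (rule HomeoI)
  have "homeomorphic_map Z Z (g \<circ> h)"
    using assms homeomorphic_map_compose by (auto simp: Homeo_def)
  then show "homeomorphic_map Z Z (compose (topspace Z) g h)"
    by (rule homeomorphic_map_eq) (simp add: compose_eq)
qed auto

text \<open>The continuous inverse supplied by \<open>homeomorphic_maps\<close> agrees on the space
  with \<open>inv_into\<close>. The restricted \<open>inv_into\<close> is the form that inverses
  take in \<open>BijGroup\<close>.\<close>

lemma Homeo_inverse:
  assumes "h \<in> Homeo Z"
  shows "restrict (inv_into (topspace Z) h) (topspace Z) \<in> Homeo Z"
proof (rule HomeoI)
  obtain k where k: "homeomorphic_maps Z Z h k"
    using assms by (auto simp: Homeo_def homeomorphic_map_maps)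
  have "k z = restrict (inv_into (topspace Z) h) (topspace Z) z" if "z \<in> topspace Z" for z
  proof -
    have "k z \<in> topspace Z" "h (k z) = z"
      using k that by (auto simp: homeomorphic_maps_def continuous_map_def)
    then show ?thesis
      using that inv_into_f_f[OF bij_betw_imp_inj_on[OF Homeo_bij_betw[OF assms]], of "k z"] by simp
  qed
  then show "homeomorphic_map Z Z (restrict (inv_into (topspace Z) h) (topspace Z))"
    using k homeomorphic_map_eq[of Z Z k] by (simp add: homeomorphic_maps_map)
qed auto

lemma subgroup_Homeo: "subgroup (Homeo Z) (BijGroup (topspace Z))"
proof (rule subgroup.intro)
  fix g h assume "g \<in> Homeo Z" "h \<in> Homeo Z"
  moreover from this have "g \<in> Bij (topspace Z)" "h \<in> Bij (topspace Z)"
    using Homeo_subset_Bij by auto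
  ultimately show "g \<otimes>\<^bsub>BijGroup (topspace Z)\<^esub> h \<in> Homeo Z"
    by (simp add: BijGroup_def Homeo_compose)
next
  have "homeomorphic_map Z Z (\<lambda>x\<in>topspace Z. x)"
    using homeomorphic_map_eq[of Z Z id] by simp
  then show "\<one>\<^bsub>BijGroup (topspace Z)\<^esub> \<in> Homeo Z"
    by (simp add: BijGroup_def HomeoI)
next
  fix h assume "h \<in> Homeo Z"
  moreover from this have "h \<in> Bij (topspace Z)"
    using Homeo_subset_Bij by auto
  ultimately show "inv\<^bsub>BijGroup (topspace Z)\<^esub> h \<in> Homeo Z"
    by (simp add: inv_BijGroup Homeo_inverse)
qed (simp add: BijGroup_def Homeo_subset_Bij)

lemma Homeo_group_mult:
  assumes "g \<in> Homeo Z" "h \<in> Homeo Z"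
  shows "g \<otimes>\<^bsub>Homeo_group Z\<^esub> h = compose (topspace Z) g h"
proof -
  have "g \<in> Bij (topspace Z)" "h \<in> Bij (topspace Z)"
    using assms Homeo_subset_Bij by auto
  then show ?thesis
    by (simp add: Homeo_group_def BijGroup_def)
qed

lemma Homeo_group_inv:
  assumes "h \<in> Homeo Z"
  shows "inv\<^bsub>Homeo_group Z\<^esub> h = restrict (inv_into (topspace Z) h) (topspace Z)"
proof -
  have "h \<in> Bij (topspace Z)"
    using assms Homeo_subset_Bij by auto
  then show ?thesis
    unfolding Homeo_group_def
    by (simp add: group.m_inv_consistent[OF group_BijGroup subgroup_Homeo assms] inv_BijGroup)
qed

lemma topspace_Homeo_pointwise [simp]: "topspace (Homeo_pointwise Z) = Homeo Z"
proof -
  have "pointwise_basic Z {} = Homeo Z"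
    by (simp add: pointwise_basic_def)
  then have "Homeo Z \<in> {pointwise_basic Z C | C. finite C \<and> C \<subseteq> topspace Z \<times> {V. openin Z V}}"
    by blast
  then show ?thesis
    unfolding Homeo_pointwise_def topology_generated_by_topspace
    by (auto simp: pointwise_basic_def)
qed

section \<open>Neighbourhood filters in the pointwise topology\<close>

abbreviation near :: "'a topology \<Rightarrow> ('a \<Rightarrow> 'a) \<Rightarrow> ('a \<Rightarrow> 'a) filter" where
  "near Z \<equiv> nhdsin (Homeo_pointwise Z)"

lemma eventually_near_Homeo:
  assumes "h \<in> Homeo Z"
  shows "\<forall>\<^sub>F f in near Z h. f \<in> Homeo Z"
proof -
  have "openin (Homeo_pointwise Z) (Homeo Z)"
    using openin_topspace[of "Homeo_pointwise Z"] by simp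
  then show ?thesis
    unfolding eventually_nhdsin using assms by blast
qed

lemma eventually_near_eval:
  assumes "h \<in> Homeo Z" "z \<in> topspace Z" "openin Z V" "h z \<in> V"
  shows "\<forall>\<^sub>F f in near Z h. f z \<in> V"
proof -
  have "openin (Homeo_pointwise Z) (pointwise_basic Z {(z, V)})"
    unfolding Homeo_pointwise_def
    by (rule topology_generated_by_Basis) (use assms in blast)
  then show ?thesis
    unfolding eventually_nhdsin using assms by (auto simp: pointwise_basic_def)
qed

text \<open>The preimage of a basic set is a finite intersection of conditions, each on the value at
  one point, so these conditions can be tested separately.\<close>

lemma continuous_map_into_Homeo_pointwise:
  assumes "\<And>t. t \<in> topspace T \<Longrightarrow> \<Phi> t \<in> Homeo Z"
    and "\<And>z V. z \<in> topspace Z \<Longrightarrow> openin Z V \<Longrightarrow> openin T {t \<in> topspace T. \<Phi> t z \<in> V}"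
  shows "continuous_map T (Homeo_pointwise Z) \<Phi>"
  unfolding Homeo_pointwise_def
proof (rule continuous_on_generated_topo)
  fix U assume "U \<in> {pointwise_basic Z C | C. finite C \<and> C \<subseteq> topspace Z \<times> {V. openin Z V}}"
  then obtain C where C: "U = pointwise_basic Z C" "finite C" "C \<subseteq> topspace Z \<times> {V. openin Z V}"
    by blast
  \<comment> \<open>The factor \<open>topspace T\<close> matters when \<open>C\<close> is empty: an
    intersection over no constraints is the whole type.\<close>
  have "\<Phi> -` U \<inter> topspace T = topspace T \<inter> (\<Inter>(z, V)\<in>C. {t \<in> topspace T. \<Phi> t z \<in> V})"
    using assms(1) unfolding C pointwise_basic_def by auto
  moreover have "openin T (topspace T \<inter> (\<Inter>(z, V)\<in>C. {t \<in> topspace T. \<Phi> t z \<in> V}))"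
  proof (cases "C = {}")
    case False
    then show ?thesis
      using C assms(2) by (intro openin_Int openin_INT2) auto
  qed simp
  ultimately show "openin T (\<Phi> -` U \<inter> topspace T)" by simp
next
  have "\<Union>{pointwise_basic Z C | C. finite C \<and> C \<subseteq> topspace Z \<times> {V. openin Z V}} = Homeo Z"
    using topspace_Homeo_pointwise[of Z]
    unfolding Homeo_pointwise_def topology_generated_by_topspace .
  then show "\<Phi> ` topspace T \<subseteq> \<Union>{pointwise_basic Z C | C. finite C \<and> C \<subseteq> topspace Z \<times> {V. openin Z V}}"
    using assms(1) by blast
qed

lemma openin_iff_eventually_nhdsin:
  "openin T S \<longleftrightarrow> S \<subseteq> topspace T \<and> (\<forall>x\<in>S. \<forall>\<^sub>F y in nhdsin T x. y \<in> S)"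
proof
  assume "openin T S"
  then show "S \<subseteq> topspace T \<and> (\<forall>x\<in>S. \<forall>\<^sub>F y in nhdsin T x. y \<in> S)"
    by (auto simp: eventually_nhdsin openin_subset)
next
  assume S: "S \<subseteq> topspace T \<and> (\<forall>x\<in>S. \<forall>\<^sub>F y in nhdsin T x. y \<in> S)"
  have "\<exists>U. openin T U \<and> x \<in> U \<and> U \<subseteq> S" if "x \<in> S" for x
  proof -
    have "x \<in> topspace T" "\<forall>\<^sub>F y in nhdsin T x. y \<in> S"
      using S that by auto
    then show ?thesis
      by (auto simp: eventually_nhdsin)
  qed
  then show "openin T S"
    by (subst openin_subopen) simp
qed

text \<open>A criterion for arbitrary spaces, with two ways to control a product
  \<open>g' (h' z)\<close>. For \<open>z\<close> in \<open>L\<close>, first \<open>h' z\<close> is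
  kept in a neighbourhood \<open>W\<close> of \<open>h z\<close>, then equicontinuity of the maps
  near \<open>g\<close> at \<open>h z\<close> takes over. For \<open>z\<close> outside
  \<open>L\<close>, \<open>h' z\<close> is exactly \<open>h z\<close>, and closeness of
  \<open>g'\<close> to \<open>g\<close> at that one point suffices. Inversion is split in the same
  way, according to whether the preimage of the given point lies in \<open>L\<close>.\<close>

theorem topological_group_Homeo:
  assumes invariant: "\<And>h z. h \<in> Homeo Z \<Longrightarrow> z \<in> topspace Z \<Longrightarrow> h z \<in> L \<longleftrightarrow> z \<in> L"
    and rigid: "\<And>h z. h \<in> Homeo Z \<Longrightarrow> z \<in> topspace Z - L \<Longrightarrow> \<forall>\<^sub>F f in near Z h. f z = h z"
    and equicontinuous: "\<And>h z V. h \<in> Homeo Z \<Longrightarrow> z \<in> topspace Z \<inter> L \<Longrightarrow> openin Z V \<Longrightarrow> h z \<in> V \<Longrightarrow>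
      \<exists>W. openin Z W \<and> z \<in> W \<and> (\<forall>\<^sub>F f in near Z h. f ` W \<subseteq> V)"
    and open_image: "\<And>h z V. h \<in> Homeo Z \<Longrightarrow> z \<in> topspace Z \<inter> L \<Longrightarrow> openin Z V \<Longrightarrow> z \<in> V \<Longrightarrow>
      \<forall>\<^sub>F f in near Z h. h z \<in> f ` V"
  shows "topological_group (Homeo_group Z) (Homeo_pointwise Z)"
  unfolding topological_group_def
proof (intro conjI)
  let ?H = "Homeo_pointwise Z"
  show "group (Homeo_group Z)"
    unfolding Homeo_group_def
    by (rule subgroup.subgroup_is_group[OF subgroup_Homeo group_BijGroup])
  show "topspace ?H = carrier (Homeo_group Z)"
    by (simp add: Homeo_group_def)
  have mult: "\<exists>A B. openin ?H A \<and> openin ?H B \<and> g \<in> A \<and> h \<in> B \<and> (\<forall>g'\<in>A. \<forall>h'\<in>B. g' (h' z) \<in> V)"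
    if g: "g \<in> Homeo Z" and h: "h \<in> Homeo Z" and z: "z \<in> topspace Z" and V: "openin Z V" "g (h z) \<in> V"
    for g h z V
  proof -
    have hz: "h z \<in> topspace Z" using Homeo_in_topspace[OF h z] .
    have "\<exists>W. (\<forall>\<^sub>F f in near Z h. f z \<in> W) \<and> (\<forall>\<^sub>F f in near Z g. f ` W \<subseteq> V)"
    proof (cases "z \<in> L")
      case True
      then have "h z \<in> topspace Z \<inter> L" using invariant[OF h z] hz by simp
      then obtain W where "openin Z W" "h z \<in> W" "\<forall>\<^sub>F f in near Z g. f ` W \<subseteq> V"
        using equicontinuous[OF g _ V] by blast
      then show ?thesis using eventually_near_eval[OF h z] by blast
    next
      case False
      \<comment> \<open>Openness of \<open>W\<close> is not asked for, so here the singleton of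
        \<open>h z\<close> can be taken.\<close>
      then have "\<forall>\<^sub>F f in near Z h. f z \<in> {h z}" using rigid[OF h, of z] z by simp
      moreover have "\<forall>\<^sub>F f in near Z g. f ` {h z} \<subseteq> V"
        using eventually_near_eval[OF g hz V] by simp
      ultimately show ?thesis by blast
    qed
    then obtain W where "\<forall>\<^sub>F f in near Z h. f z \<in> W" "\<forall>\<^sub>F f in near Z g. f ` W \<subseteq> V" by blast
    then obtain A B where "openin ?H A" "g \<in> A" "\<forall>g'\<in>A. g' ` W \<subseteq> V"
      and "openin ?H B" "h \<in> B" "\<forall>h'\<in>B. h' z \<in> W"
      using g h unfolding eventually_nhdsin topspace_Homeo_pointwise by meson
    then show ?thesis by (metis image_subset_iff)
  qed
  show "continuous_map (prod_topology ?H ?H) ?H (\<lambda>(g, h). g \<otimes>\<^bsub>Homeo_group Z\<^esub> h)"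
  proof (rule continuous_map_into_Homeo_pointwise)
    fix z V assume z: "z \<in> topspace Z" and V: "openin Z V"
    let ?S = "{t \<in> topspace (prod_topology ?H ?H). (case t of (g, h) \<Rightarrow> g \<otimes>\<^bsub>Homeo_group Z\<^esub> h) z \<in> V}"
    have S: "(g, h) \<in> ?S \<longleftrightarrow> g \<in> Homeo Z \<and> h \<in> Homeo Z \<and> g (h z) \<in> V" for g h
      using z by (auto simp: Homeo_group_mult compose_eq)
    show "openin (prod_topology ?H ?H) ?S"
      unfolding openin_prod_topology_alt
    proof (intro allI impI)
      fix g h assume "(g, h) \<in> ?S"
      then have "g \<in> Homeo Z" "h \<in> Homeo Z" "g (h z) \<in> V" unfolding S by auto
      then obtain A B where AB: "openin ?H A" "openin ?H B" "g \<in> A" "h \<in> B"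
        "\<forall>g'\<in>A. \<forall>h'\<in>B. g' (h' z) \<in> V"
        using mult[OF _ _ z V] by metis
      have sub: "A \<subseteq> Homeo Z" "B \<subseteq> Homeo Z"
        using AB openin_subset[of ?H] by simp_all
      have "(g', h') \<in> ?S" if "g' \<in> A" "h' \<in> B" for g' h'
        by (rule S[THEN iffD2]) (use that sub AB(5) in blast)
      then have "A \<times> B \<subseteq> ?S" by auto
      then show "\<exists>U V. openin ?H U \<and> openin ?H V \<and> g \<in> U \<and> h \<in> V \<and> U \<times> V \<subseteq> ?S"
        using AB by blast
    qed
  qed (auto simp: Homeo_group_mult Homeo_compose)
  show "continuous_map ?H ?H (\<lambda>h. inv\<^bsub>Homeo_group Z\<^esub> h)"
  proof (rule continuous_map_into_Homeo_pointwise)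
    fix z V assume z: "z \<in> topspace Z" and V: "openin Z V"
    let ?S = "{h \<in> topspace ?H. (inv\<^bsub>Homeo_group Z\<^esub> h) z \<in> V}"
    \<comment> \<open>Passing from the inverse to the image of \<open>V\<close> gives the form in
      which \<open>open_image\<close> applies.\<close>
    have S: "?S = {h \<in> Homeo Z. z \<in> h ` V}"
    proof -
      have "inv_into (topspace Z) h z \<in> V \<longleftrightarrow> z \<in> h ` V" if h: "h \<in> Homeo Z" for h
      proof -
        have inj: "inj_on h (topspace Z)" and "h ` topspace Z = topspace Z"
          using Homeo_bij_betw[OF h] by (auto simp: bij_betw_def)
        then have "h (inv_into (topspace Z) h z) = z"
          using f_inv_into_f[of z h] z by simp
        moreover have "inv_into (topspace Z) h (h w) = w" if "w \<in> V" for w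
          using inv_into_f_f[OF inj] openin_subset[OF V] that by blast
        ultimately show ?thesis
          by (metis imageE imageI)
      qed
      then show ?thesis
        using z by (auto simp: Homeo_group_inv)
    qed
    have "\<forall>\<^sub>F f in near Z h. z \<in> f ` V" if h: "h \<in> Homeo Z" and zV: "z \<in> h ` V" for h
    proof -
      obtain w where w: "w \<in> V" "z = h w" using zV by blast
      have wZ: "w \<in> topspace Z" using w V openin_subset by blast
      show ?thesis
      proof (cases "w \<in> L")
        case True
        then show ?thesis using open_image[OF h _ V] w wZ by blast
      next
        case False
        then have "\<forall>\<^sub>F f in near Z h. f w = h w" using rigid[OF h] wZ by blast
        then show ?thesis
          by (rule eventually_mono) (use w in \<open>metis imageI\<close>)
      qed
    qed
    then show "openin ?H ?S"
      unfolding S openin_iff_eventually_nhdsin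
      by (auto simp: eventually_conj_iff eventually_near_Homeo)
  qed (simp add: Homeo_group_inv Homeo_inverse)
qed

section \<open>Points with a compact neighbourhood, as a topological invariant\<close>

definition compact_locus :: "'a topology \<Rightarrow> 'a set" where
  "compact_locus Z = {z. \<exists>U K. openin Z U \<and> compactin Z K \<and> z \<in> U \<and> U \<subseteq> K}"

lemma homeomorphic_map_compact_locus:
  assumes "homeomorphic_map Z Z h" "z \<in> compact_locus Z"
  shows "h z \<in> compact_locus Z"
proof -
  obtain U K where "openin Z U" "compactin Z K" "z \<in> U" "U \<subseteq> K"
    using assms(2) by (auto simp: compact_locus_def)
  moreover from this have "openin Z (h ` U)" "compactin Z (h ` K)"
    using assms(1) by (auto simp: homeomorphic_eq_everything_map open_map_def intro: image_compactin)
  ultimately show ?thesis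
    unfolding compact_locus_def by blast
qed

text \<open>Compact neighbourhoods are carried forward by the homeomorphism and back by its
  inverse.\<close>

lemma Homeo_compact_locus_iff:
  assumes "h \<in> Homeo Z" "z \<in> topspace Z"
  shows "h z \<in> compact_locus Z \<longleftrightarrow> z \<in> compact_locus Z"
proof -
  obtain k where k: "homeomorphic_maps Z Z h k"
    using assms(1) unfolding Homeo_def homeomorphic_map_maps by blast
  then have hk: "homeomorphic_map Z Z h" "homeomorphic_map Z Z k" and "k (h z) = z"
    using assms(2) unfolding homeomorphic_maps_map by simp_all
  then show ?thesis
    using homeomorphic_map_compact_locus[OF hk(1), of z] homeomorphic_map_compact_locus[OF hk(2), of "h z"]
    by metis
qed

text \<open>Points of the discrete factor are open, so a neighbourhood in the product can be shrunk
  into a single slice, and openness is a matter of the slices.\<close>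

lemma openin_prod_discrete_topology:
  assumes "S \<subseteq> D \<times> topspace Y"
  shows "openin (prod_topology (discrete_topology D) Y) S \<longleftrightarrow> (\<forall>x\<in>D. openin Y {t. (x, t) \<in> S})"
proof
  assume S: "openin (prod_topology (discrete_topology D) Y) S"
  show "\<forall>x\<in>D. openin Y {t. (x, t) \<in> S}"
  proof
    fix x assume "x \<in> D"
    have "\<exists>V. openin Y V \<and> t \<in> V \<and> V \<subseteq> {t. (x, t) \<in> S}" if t: "(x, t) \<in> S" for t
    proof -
      obtain U V where "openin Y V" "x \<in> U" "t \<in> V" "U \<times> V \<subseteq> S"
        using S[unfolded openin_prod_topology_alt] t by metis
      then show ?thesis by blast
    qed
    then show "openin Y {t. (x, t) \<in> S}"
      by (subst openin_subopen) simp
  qed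
next
  assume S: "\<forall>x\<in>D. openin Y {t. (x, t) \<in> S}"
  show "openin (prod_topology (discrete_topology D) Y) S"
    unfolding openin_prod_topology_alt
  proof (intro allI impI)
    fix x t assume "(x, t) \<in> S"
    moreover from this have "x \<in> D" using assms by blast
    ultimately have "openin (discrete_topology D) {x}" "openin Y {t. (x, t) \<in> S}" "t \<in> {t. (x, t) \<in> S}"
      using S by auto
    moreover have "{x} \<times> {t. (x, t) \<in> S} \<subseteq> S" by blast
    ultimately show "\<exists>U V. openin (discrete_topology D) U \<and> openin Y V \<and> x \<in> U \<and> t \<in> V \<and> U \<times> V \<subseteq> S"
      by (metis singletonI)
  qed
qed

section \<open>The topology of the noodles\<close>

text \<open>The class of the point at height \<open>t\<close> above \<open>x\<close>. Taking the
  glued pair at height \<open>0\<close> makes this an injective parametrisation of the whole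
  quotient, base points included.\<close>

definition noodle :: "'a \<Rightarrow> real \<Rightarrow> ('a + 'a \<times> real) set" where
  "noodle x t = (if t = 0 then {Inl x, Inr (x, 0)} else {Inr (x, t)})"

lemma noodle_eq_iff [simp]: "noodle x s = noodle y t \<longleftrightarrow> x = y \<and> s = t"
  by (simp add: noodle_def doubleton_eq_iff)

lemma noodle_partition_eq:
  "noodle_partition X = {noodle x t | x t. x \<in> topspace X \<and> t \<in> {0..1}}" (is "_ = ?R")
proof
  have U: "\<Union>(noodle_gluings X) = Inl ` topspace X \<union> Inr ` (topspace X \<times> {0})"
    by (auto simp: noodle_gluings_def)
  have T: "topspace (noodle_sum X) = Inl ` topspace X \<union> Inr ` (topspace X \<times> {0..1})"
    by (auto simp: noodle_sum_def topspace_disjoint_sum)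
  show "noodle_partition X \<subseteq> ?R"
  proof
    fix P assume "P \<in> noodle_partition X"
    then consider x where "x \<in> topspace X" "P = {Inl x, Inr (x, 0)}"
      | x t where "x \<in> topspace X" "t \<in> {0..1}" "t \<noteq> 0" "P = {Inr (x, t)}"
      unfolding noodle_partition_def U T by (auto simp: noodle_gluings_def) blast
    then show "P \<in> ?R"
    proof cases
      case 1
      then have "P = noodle x 0" by (simp add: noodle_def)
      with 1 show ?thesis by force
    next
      case 2
      then have "P = noodle x t" by (simp add: noodle_def)
      with 2 show ?thesis by blast
    qed
  qed
  show "?R \<subseteq> noodle_partition X"
  proof
    fix P assume "P \<in> ?R"
    then obtain x t where "x \<in> topspace X" "t \<in> {0..1}" "P = noodle x t" by blast
    then show "P \<in> noodle_partition X"
      unfolding noodle_partition_def U T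
      by (cases "t = 0") (auto simp: noodle_gluings_def noodle_def)
  qed
qed

lemma topspace_Alexandroff_noodles:
  "topspace (Alexandroff_noodles X) = {noodle x t | x t. x \<in> topspace X \<and> t \<in> {0..1}}"
  unfolding Alexandroff_noodles_def
  by (rule trans[OF topspace_quotient_space[OF partition_on_noodle_partition] noodle_partition_eq])

lemma noodle_in_topspace [simp]:
  "noodle x t \<in> topspace (Alexandroff_noodles X) \<longleftrightarrow> x \<in> topspace X \<and> 0 \<le> t \<and> t \<le> 1"
  by (auto simp: topspace_Alexandroff_noodles)

text \<open>The union of the classes in \<open>U\<close> is traced on both summands, and its trace
  on the product with the discrete factor is examined slice by slice. No uniformity across noodles
  is involved: the heights available in \<open>U\<close> may vary arbitrarily with
  \<open>x\<close>.\<close>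

lemma openin_Alexandroff_noodles:
  "openin (Alexandroff_noodles X) U \<longleftrightarrow>
     U \<subseteq> topspace (Alexandroff_noodles X) \<and>
     openin X {x \<in> topspace X. noodle x 0 \<in> U} \<and>
     (\<forall>x\<in>topspace X. openin (top_of_set {0..1}) {t \<in> {0..1}. noodle x t \<in> U})"
proof (cases "U \<subseteq> topspace (Alexandroff_noodles X)")
  case True
  let ?S = "{(x, t). x \<in> topspace X \<and> t \<in> {0..1} \<and> noodle x t \<in> U}"
  have mem: "\<exists>x t. x \<in> topspace X \<and> t \<in> {0..1} \<and> P = noodle x t" if "P \<in> U" for P
    using True that by (auto simp: topspace_Alexandroff_noodles)
  have "Inl x \<in> \<Union>U \<longleftrightarrow> x \<in> topspace X \<and> noodle x 0 \<in> U" for x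
  proof
    assume "Inl x \<in> \<Union>U"
    then obtain P where P: "P \<in> U" "Inl x \<in> P" by blast
    then obtain y t where "y \<in> topspace X" "P = noodle y t" using mem by blast
    with P show "x \<in> topspace X \<and> noodle x 0 \<in> U"
      by (auto simp: noodle_def split: if_splits)
  qed (auto simp: noodle_def)
  then have Inl: "Inl -` \<Union>U = {x \<in> topspace X. noodle x 0 \<in> U}" by auto
  have "Inr (x, t) \<in> \<Union>U \<longleftrightarrow> (x, t) \<in> ?S" for x t
  proof
    assume "Inr (x, t) \<in> \<Union>U"
    then obtain P where P: "P \<in> U" "Inr (x, t) \<in> P" by blast
    then obtain y s where ys: "y \<in> topspace X" "s \<in> {0..1}" "P = noodle y s" using mem by blast
    with P(2) have "x = y" "s = t" by (auto simp: noodle_def split: if_splits)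
    with P ys show "(x, t) \<in> ?S" by simp
  next
    assume "(x, t) \<in> ?S"
    moreover have "Inr (x, t) \<in> noodle x t" by (simp add: noodle_def)
    ultimately show "Inr (x, t) \<in> \<Union>U" by blast
  qed
  then have Inr: "Inr -` \<Union>U = ?S" by auto
  have "?S \<subseteq> topspace X \<times> topspace (top_of_set {0..1})" by auto
  then have "openin (prod_topology (discrete_topology (topspace X)) (top_of_set {0..1})) ?S \<longleftrightarrow>
    (\<forall>x\<in>topspace X. openin (top_of_set {0..1}) {t \<in> {0..1}. noodle x t \<in> U})"
    by (simp only: openin_prod_discrete_topology) (simp cong: conj_cong)
  moreover have "openin (Alexandroff_noodles X) U \<longleftrightarrow> openin (noodle_sum X) (\<Union>U)"
    using True unfolding Alexandroff_noodles_def
    by (simp add: openin_quotient_space[OF partition_on_noodle_partition]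
        topspace_quotient_space[OF partition_on_noodle_partition])
  ultimately show ?thesis
    using True unfolding noodle_sum_def openin_disjoint_sum Inl Inr by simp
next
  case False
  then show ?thesis using openin_subset by blast
qed

lemma openin_unit_interval_ball:
  fixes T :: "real set"
  assumes "openin (top_of_set {0..1}) T" "s \<in> T"
  obtains d where "d > 0" "\<And>u. u \<in> {0..1} \<Longrightarrow> \<bar>u - s\<bar> < d \<Longrightarrow> u \<in> T"
  using assms unfolding openin_euclidean_subtopology_iff dist_real_def by blast

lemma continuous_map_noodle:
  assumes "x \<in> topspace X"
  shows "continuous_map (top_of_set {0..1}) (Alexandroff_noodles X) (noodle x)"
  using assms by (auto simp: continuous_map_def openin_Alexandroff_noodles)

text \<open>The coordinate on the noodle of \<open>y\<close>, extended by its value \<open>0\<close> at the base point to all other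
  noodles, which makes it continuous.\<close>

definition coord :: "'a \<Rightarrow> ('a + 'a \<times> real) set \<Rightarrow> real" where
  "coord y P = (if P \<in> range (noodle y) then the_inv (noodle y) P else 0)"

lemma coord_noodle [simp]: "coord y (noodle x t) = (if x = y then t else 0)"
proof -
  have "inj (noodle y)" by (auto simp: inj_def)
  then show ?thesis by (auto simp: coord_def the_inv_f_f)
qed

text \<open>On the noodle of \<open>y\<close> the preimage of \<open>V\<close> is the trace of
  \<open>V\<close> on the unit interval. On every other noodle, and on the set of base points, it is
  everything or nothing, depending on whether \<open>V\<close> contains \<open>0\<close>.\<close>

lemma continuous_map_coord: "continuous_map (Alexandroff_noodles X) euclideanreal (coord y)"
proof -
  have "openin (Alexandroff_noodles X) {z \<in> topspace (Alexandroff_noodles X). coord y z \<in> V}"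
    if "open V" for V
  proof -
    have "openin (top_of_set {0..1}) {t \<in> {0..1}. (if x = y then t else 0) \<in> V}" for x
    proof (cases "x = y")
      case True
      have "{t \<in> {0..1}. t \<in> V} = {0..1} \<inter> V" by auto
      then show ?thesis using True \<open>open V\<close> by (simp add: openin_open_Int)
    next
      case False
      then have "{t \<in> {0..1}. (if x = y then t else 0) \<in> V} = (if 0 \<in> V then {0..1} else {})"
        by auto
      then show ?thesis by (simp only:) simp
    qed
    then show ?thesis
      by (cases "0 \<in> V") (auto simp: openin_Alexandroff_noodles cong: conj_cong)
  qed
  then show ?thesis by (simp add: continuous_map_def)
qed

section \<open>Compactness, openness and closedness of single noodles\<close>

definition strand :: "'a \<Rightarrow> ('a + 'a \<times> real) set set" where
  "strand x = noodle x ` {0..1}"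

lemma noodle_in_strand [simp]: "noodle x t \<in> strand y \<longleftrightarrow> x = y \<and> 0 \<le> t \<and> t \<le> 1"
  by (auto simp: strand_def)

lemma compactin_strand: "x \<in> topspace X \<Longrightarrow> compactin (Alexandroff_noodles X) (strand x)"
  unfolding strand_def
  by (rule image_compactin[OF _ continuous_map_noodle]) (auto simp: compactin_subtopology)

text \<open>It is the set where the continuous function \<open>coord x\<close> is positive.\<close>

lemma openin_open_strand:
  assumes "x \<in> topspace X"
  shows "openin (Alexandroff_noodles X) (noodle x ` {0<..1})"
proof -
  have "openin (Alexandroff_noodles X) {z \<in> topspace (Alexandroff_noodles X). coord x z \<in> {0<..}}"
    using continuous_map_coord[of X x] unfolding continuous_map_def by (auto simp del: greaterThan_iff)
  moreover have "{z \<in> topspace (Alexandroff_noodles X). coord x z \<in> {0<..}} = noodle x ` {0<..1}"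
    using assms by (auto simp: topspace_Alexandroff_noodles image_iff split: if_splits)
  ultimately show ?thesis by simp
qed

lemma openin_strand:
  assumes "openin X {x}"
  shows "openin (Alexandroff_noodles X) (strand x)"
proof -
  have x: "x \<in> topspace X" using openin_subset[OF assms] by simp
  then have "{y \<in> topspace X. noodle y 0 \<in> strand x} = {x}"
    and "{t \<in> {0..1}. noodle y t \<in> strand x} = (if y = x then {0..1} else {})" for y
    by auto
  moreover have "strand x \<subseteq> topspace (Alexandroff_noodles X)"
    using x by (auto simp: strand_def)
  ultimately show ?thesis
    using assms by (simp add: openin_Alexandroff_noodles)
qed

text \<open>The complement contains every base point except that of \<open>x\<close>, and this is an
  open set of base points because points of \<open>X\<close> are closed.\<close>

lemma closedin_strand:
  assumes "t1_space X" "x \<in> topspace X"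
  shows "closedin (Alexandroff_noodles X) (strand x)"
proof -
  have "{y \<in> topspace X. noodle y 0 \<in> topspace (Alexandroff_noodles X) - strand x} = topspace X - {x}"
    by auto
  moreover have "openin X (topspace X - {x})"
    using assms by (simp add: t1_space_closedin_singleton openin_diff)
  moreover have "{t \<in> {0..1}. noodle y t \<in> topspace (Alexandroff_noodles X) - strand x} =
    (if y = x then {} else {0..1})" if "y \<in> topspace X" for y
    using that by auto
  moreover have "strand x \<subseteq> topspace (Alexandroff_noodles X)"
    using assms by (auto simp: strand_def)
  ultimately show ?thesis
    unfolding closedin_def openin_Alexandroff_noodles by simp
qed

text \<open>A compact neighbourhood of a non-isolated point of \<open>X\<close> would meet infinitely many noodles away
  from their base points; choosing one such point on each of them gives an infinite closed discrete set.\<close>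

lemma noodle_in_compact_locus_iff:
  assumes t1: "t1_space X" and x: "x \<in> topspace X" and t: "t \<in> {0..1}"
  shows "noodle x t \<in> compact_locus (Alexandroff_noodles X) \<longleftrightarrow> t \<noteq> 0 \<or> openin X {x}"
proof
  assume "t \<noteq> 0 \<or> openin X {x}"
  then show "noodle x t \<in> compact_locus (Alexandroff_noodles X)"
  proof
    assume "t \<noteq> 0"
    then have "noodle x t \<in> noodle x ` {0<..1}" "noodle x ` {0<..1} \<subseteq> strand x"
      using t by (auto simp: strand_def)
    then show ?thesis
      unfolding compact_locus_def using openin_open_strand[OF x] compactin_strand[OF x] by blast
  next
    assume "openin X {x}"
    moreover have "noodle x t \<in> strand x" using t by simp
    ultimately show ?thesis
      unfolding compact_locus_def using openin_strand[of X x] compactin_strand[OF x] by blast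
  qed
next
  let ?Z = "Alexandroff_noodles X"
  assume *: "noodle x t \<in> compact_locus (Alexandroff_noodles X)"
  have "openin X {x}" if "t = 0"
  proof -
    have "noodle x 0 \<in> compact_locus ?Z" using * that by simp
    then obtain U K where U: "openin ?Z U" "noodle x 0 \<in> U" and K: "compactin ?Z K" "U \<subseteq> K"
      unfolding compact_locus_def by blast
    define W where "W = {y \<in> topspace X. noodle y 0 \<in> U}"
    have W: "openin X W" "x \<in> W" "W \<subseteq> topspace X"
      using U x by (auto simp: W_def openin_Alexandroff_noodles)
    have "\<exists>e. 0 < e \<and> e \<le> 1 \<and> noodle y e \<in> U" if "y \<in> W" for y
    proof -
      have "openin (top_of_set {0..1}) {t \<in> {0..1}. noodle y t \<in> U}" "0 \<in> {t \<in> {0..1}. noodle y t \<in> U}"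
        using U that by (auto simp: W_def openin_Alexandroff_noodles)
      then obtain d where d: "d > 0" "\<And>u. u \<in> {0..1} \<Longrightarrow> \<bar>u - 0\<bar> < d \<Longrightarrow> u \<in> {t \<in> {0..1}. noodle y t \<in> U}"
        using openin_unit_interval_ball by blast
      \<comment> \<open>Half the radius stays strictly below \<open>d\<close>, and the cap at
        \<open>1\<close> keeps the height in the unit interval.\<close>
      have "noodle y (min 1 (d / 2)) \<in> U"
        using d(2)[of "min 1 (d / 2)"] \<open>d > 0\<close> by (auto simp: min_def)
      then show ?thesis
        using \<open>d > 0\<close> by (intro exI[of _ "min 1 (d / 2)"]) auto
    qed
    then obtain e where e: "\<And>y. y \<in> W \<Longrightarrow> 0 < e y" "\<And>y. y \<in> W \<Longrightarrow> e y \<le> 1" "\<And>y. y \<in> W \<Longrightarrow> noodle y (e y) \<in> U"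
      by metis
    define S where "S = (\<lambda>y. noodle y (e y)) ` W"
    \<comment> \<open>For \<open>y\<close> in \<open>W\<close>, the point of \<open>S\<close> above
      \<open>y\<close> is the only one left in \<open>O' y\<close>. A finite subcover of
      \<open>K\<close>, which contains \<open>S\<close>, therefore forces \<open>S\<close> and with
      it \<open>W\<close> to be finite.\<close>
    define O' where "O' y = topspace ?Z - (S - {noodle y (e y)})" for y
    have "openin ?Z (O' y)" for y
    proof -
      \<comment> \<open>All heights \<open>e v\<close> with \<open>v\<close> in \<open>W\<close> are
        positive, so no base point is removed; each noodle loses at most one point.\<close>
      have "{v \<in> topspace X. noodle v 0 \<in> O' y} = topspace X"
        using e(1) by (fastforce simp: O'_def S_def)
      moreover have "openin (top_of_set {0..1}) {t \<in> {0..1}. noodle v t \<in> O' y}" if "v \<in> topspace X" for v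
      proof -
        have "{t \<in> {0..1}. noodle v t \<in> O' y} = {0..1} \<inter> - {t. t = e v \<and> v \<in> W \<and> v \<noteq> y}"
          using that by (auto simp: O'_def S_def)
        moreover have "finite {t. t = e v \<and> v \<in> W \<and> v \<noteq> y}" by simp
        ultimately show ?thesis
          by (metis finite_imp_closed open_Compl openin_open_Int)
      qed
      ultimately show ?thesis
        by (auto simp: openin_Alexandroff_noodles O'_def)
    qed
    moreover have "K \<subseteq> \<Union>(O' ` W)"
    proof
      fix z assume "z \<in> K"
      then have "z \<in> topspace ?Z" using K compactin_subset_topspace by blast
      then show "z \<in> \<Union>(O' ` W)"
        using W(2) by (cases "z \<in> S") (auto simp: O'_def S_def)
    qed
    ultimately have "(\<forall>V\<in>O' ` W. openin ?Z V) \<and> K \<subseteq> \<Union>(O' ` W)" by blast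
    then obtain \<F> where "finite \<F>" "\<F> \<subseteq> O' ` W" "K \<subseteq> \<Union>\<F>"
      using K(1)[unfolded compactin_def, THEN conjunct2, rule_format] by meson
    then obtain W' where W': "finite W'" "W' \<subseteq> W" "K \<subseteq> \<Union>(O' ` W')"
      by (metis finite_subset_image)
    have "y \<in> W'" if "y \<in> W" for y
    proof -
      have "noodle y (e y) \<in> K" using e(3) K(2) that by blast
      then obtain v where v: "v \<in> W'" "noodle y (e y) \<in> O' v" using W'(3) by blast
      moreover have "noodle y (e y) \<in> S" using that by (simp add: S_def)
      ultimately have "noodle y (e y) = noodle v (e v)" by (simp add: O'_def)
      then show ?thesis using v by simp
    qed
    then have "W \<subseteq> W'" by (rule subsetI)
    \<comment> \<open>Finite sets are closed in a \<open>t1_space\<close>, so taking the finitely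
      many points other than \<open>x\<close> out of the open set \<open>W\<close> leaves an open
      singleton.\<close>
    then have "finite (W - {x})" "W - {x} \<subseteq> topspace X"
      using finite_subset[OF _ W'(1)] W(3) by auto
    then have "closedin X (W - {x})"
      using t1 unfolding t1_space_closedin_finite by simp
    then have "openin X (W - (W - {x}))" by (rule openin_diff[OF W(1)])
    moreover have "W - (W - {x}) = {x}" using W(2) by blast
    ultimately show ?thesis by simp
  qed
  then show "t \<noteq> 0 \<or> openin X {x}" by blast
qed

section \<open>Homeomorphisms permute the noodles\<close>

text \<open>Cutting with the compact locus, which homeomorphisms preserve, drops the base point
  exactly when \<open>x\<close> is not isolated. The arms are then disjoint, connected and open, and
  together they fill the compact locus.\<close>

definition arm :: "'a topology \<Rightarrow> 'a \<Rightarrow> ('a + 'a \<times> real) set set" where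
  "arm X x = strand x \<inter> compact_locus (Alexandroff_noodles X)"

lemma arm_eq:
  assumes "t1_space X" "x \<in> topspace X"
  shows "arm X x = noodle x ` (if openin X {x} then {0..1} else {0<..1})"
  using assms by (auto simp: arm_def strand_def noodle_in_compact_locus_iff)

lemma noodle_in_arm_iff:
  assumes "t1_space X" "x \<in> topspace X"
  shows "noodle x t \<in> arm X y \<longleftrightarrow> x = y \<and> 0 \<le> t \<and> t \<le> 1 \<and> (t \<noteq> 0 \<or> openin X {x})"
  using noodle_in_compact_locus_iff[OF assms, of t] by (auto simp: arm_def)

lemma openin_arm:
  assumes "t1_space X" "x \<in> topspace X"
  shows "openin (Alexandroff_noodles X) (arm X x)"
  using arm_eq[OF assms] openin_open_strand[OF assms(2)] openin_strand[of X x]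
  by (cases "openin X {x}") (simp_all flip: strand_def)

lemma connectedin_arm:
  assumes "t1_space X" "x \<in> topspace X"
  shows "connectedin (Alexandroff_noodles X) (arm X x)"
  unfolding arm_eq[OF assms]
  by (rule connectedin_continuous_map_image[OF continuous_map_noodle[OF assms(2)]])
     (auto simp: connectedin_subtopology)

text \<open>A base point missing from the arm is still a limit of points at small positive heights,
  and the whole noodle is closed.\<close>

lemma closure_of_arm:
  assumes "t1_space X" "x \<in> topspace X"
  shows "Alexandroff_noodles X closure_of arm X x = strand x"
proof
  show "Alexandroff_noodles X closure_of arm X x \<subseteq> strand x"
    by (rule closure_of_minimal[OF _ closedin_strand[OF assms]]) (simp add: arm_def)
  have "\<exists>P. P \<in> arm X x \<and> P \<in> U"
    if t: "t \<in> {0..1}" and U: "noodle x t \<in> U" "openin (Alexandroff_noodles X) U" for t U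
  proof (cases "t = 0")
    case True
    have "openin (top_of_set {0..1}) {t \<in> {0..1}. noodle x t \<in> U}" "0 \<in> {t \<in> {0..1}. noodle x t \<in> U}"
      using U assms(2) True by (auto simp: openin_Alexandroff_noodles)
    then obtain d where d: "d > 0" "\<And>u. u \<in> {0..1} \<Longrightarrow> \<bar>u - 0\<bar> < d \<Longrightarrow> u \<in> {t \<in> {0..1}. noodle x t \<in> U}"
      using openin_unit_interval_ball by blast
    have "noodle x (min 1 (d / 2)) \<in> U" "noodle x (min 1 (d / 2)) \<in> arm X x"
      using d(2)[of "min 1 (d / 2)"] \<open>d > 0\<close> by (auto simp: min_def noodle_in_arm_iff[OF assms])
    then show ?thesis by blast
  next
    case False
    then have "noodle x t \<in> arm X x" using t by (simp add: noodle_in_arm_iff[OF assms])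
    then show ?thesis using U(1) by blast
  qed
  then show "strand x \<subseteq> Alexandroff_noodles X closure_of arm X x"
    using assms(2) by (auto simp: strand_def in_closure_of)
qed

text \<open>The image is connected and stays in the compact locus, which the arms cover. The arm of
  \<open>y\<close> and the union \<open>V\<close> of all other arms are open and disjoint, so an
  image meeting the first cannot meet the second.\<close>

lemma Homeo_image_arm_subset:
  assumes t1: "t1_space X" and h: "h \<in> Homeo (Alexandroff_noodles X)"
    and xy: "x \<in> topspace X" "y \<in> topspace X" and z: "z \<in> arm X x" "h z \<in> arm X y"
  shows "h ` arm X x \<subseteq> arm X y"
proof -
  let ?Z = "Alexandroff_noodles X"
  define V where "V = \<Union>(arm X ` (topspace X - {y}))"
  have "continuous_map ?Z ?Z h"
    using h by (simp add: Homeo_def homeomorphic_imp_continuous_map)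
  then have "connectedin ?Z (h ` arm X x)"
    using connectedin_arm[OF t1 xy(1)] by (rule connectedin_continuous_map_image)
  moreover have "openin ?Z V" "openin ?Z (arm X y)"
    unfolding V_def using openin_arm[OF t1] xy(2) by auto
  moreover have "arm X y \<inter> V = {}"
    unfolding V_def by (auto simp: arm_def strand_def)
  moreover have sub: "h ` arm X x \<subseteq> arm X y \<union> V"
  proof
    fix q assume "q \<in> h ` arm X x"
    then obtain p where p: "p \<in> arm X x" "q = h p" by blast
    then have "p \<in> topspace ?Z" "p \<in> compact_locus ?Z"
      using xy(1) by (auto simp: arm_def strand_def)
    then have q: "q \<in> topspace ?Z" "q \<in> compact_locus ?Z"
      using Homeo_in_topspace[OF h] Homeo_compact_locus_iff[OF h] p(2) by auto
    then obtain v t where "v \<in> topspace X" "q = noodle v t" "t \<in> {0..1}"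
      by (auto simp: topspace_Alexandroff_noodles)
    with q have "q \<in> arm X v" "v \<in> topspace X" by (auto simp: arm_def)
    then show "q \<in> arm X y \<union> V" unfolding V_def by blast
  qed
  moreover have "arm X y \<inter> h ` arm X x \<noteq> {}" using z by blast
  ultimately have "V \<inter> h ` arm X x = {}"
    unfolding connectedin by blast
  then show ?thesis using sub by blast
qed

text \<open>The reverse inclusion is the previous one for the inverse homeomorphism
  \<open>k\<close>, which sends \<open>h z\<close> back to \<open>z\<close>.\<close>

lemma Homeo_image_arm:
  assumes t1: "t1_space X" and h: "h \<in> Homeo (Alexandroff_noodles X)"
    and xy: "x \<in> topspace X" "y \<in> topspace X" and z: "z \<in> arm X x" "h z \<in> arm X y"
  shows "h ` arm X x = arm X y"
proof
  let ?Z = "Alexandroff_noodles X"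
  show "h ` arm X x \<subseteq> arm X y"
    by (rule Homeo_image_arm_subset[OF assms])
  define k where "k = restrict (inv_into (topspace ?Z) h) (topspace ?Z)"
  have k: "k \<in> Homeo ?Z"
    unfolding k_def by (rule Homeo_inverse[OF h])
  have sub: "arm X v \<subseteq> topspace ?Z" if "v \<in> topspace X" for v
    using that by (auto simp: arm_def strand_def)
  have bij: "bij_betw h (topspace ?Z) (topspace ?Z)"
    by (rule Homeo_bij_betw[OF h])
  have hk: "h (k w) = w" if "w \<in> topspace ?Z" for w
    using bij_betw_inv_into_right[OF bij that] that by (simp add: k_def)
  have "z \<in> topspace ?Z" "h z \<in> topspace ?Z" using z sub xy by auto
  then have "k (h z) = z"
    using bij_betw_inv_into_left[OF bij] by (simp add: k_def)
  then have k_sub: "k ` arm X y \<subseteq> arm X x"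
    using Homeo_image_arm_subset[OF t1 k xy(2) xy(1) z(2)] z(1) by simp
  show "arm X y \<subseteq> h ` arm X x"
  proof
    fix w assume w: "w \<in> arm X y"
    have "w = h (k w)" using hk sub[OF xy(2)] w by auto
    then show "w \<in> h ` arm X x" using k_sub w by blast
  qed
qed

text \<open>Homeomorphisms commute with closure, and noodles are the closures of their arms. The
  free end serves as test point because it belongs to the arm whether or not \<open>x\<close> is
  isolated.\<close>

lemma Homeo_image_strand:
  assumes t1: "t1_space X" and h: "h \<in> Homeo (Alexandroff_noodles X)"
    and xy: "x \<in> topspace X" "y \<in> topspace X" and "h (noodle x 1) \<in> arm X y"
  shows "h ` strand x = strand y"
proof -
  let ?Z = "Alexandroff_noodles X"
  have "noodle x 1 \<in> arm X x"
    by (simp add: noodle_in_arm_iff[OF t1 xy(1)])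
  then have "h ` arm X x = arm X y"
    using Homeo_image_arm[OF t1 h xy] assms(5) by blast
  moreover have "homeomorphic_map ?Z ?Z h" using h by (simp add: Homeo_def)
  moreover have "arm X x \<subseteq> topspace ?Z"
    using xy(1) by (auto simp: arm_def strand_def)
  ultimately show ?thesis
    using homeomorphic_map_closure_of[of ?Z ?Z h "arm X x"] closure_of_arm[OF t1] xy by simp
qed

text \<open>The free end has a compact neighbourhood, hence so does its image, which must lie in
  some arm. This supplies the target noodle.\<close>

lemma Homeo_noodle_end:
  assumes t1: "t1_space X" and h: "h \<in> Homeo (Alexandroff_noodles X)" and x: "x \<in> topspace X"
  obtains y where "y \<in> topspace X" "h (noodle x 1) \<in> arm X y"
proof -
  let ?Z = "Alexandroff_noodles X"
  have "noodle x 1 \<in> topspace ?Z" "noodle x 1 \<in> compact_locus ?Z"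
    using x by (simp_all add: noodle_in_compact_locus_iff[OF t1])
  then have *: "h (noodle x 1) \<in> topspace ?Z" "h (noodle x 1) \<in> compact_locus ?Z"
    using Homeo_in_topspace[OF h] Homeo_compact_locus_iff[OF h] by auto
  then obtain y t where "y \<in> topspace X" "h (noodle x 1) = noodle y t" "t \<in> {0..1}"
    by (auto simp: topspace_Alexandroff_noodles)
  then show ?thesis
    using * that[of y] by (simp add: arm_def)
qed

text \<open>The image stays on the noodle of \<open>y\<close> and outside the compact locus; only
  the base point of \<open>y\<close> meets both conditions.\<close>

lemma Homeo_noodle_base:
  assumes t1: "t1_space X" and h: "h \<in> Homeo (Alexandroff_noodles X)"
    and xy: "x \<in> topspace X" "y \<in> topspace X" and end_in: "h (noodle x 1) \<in> arm X y"
    and x0: "noodle x 0 \<notin> compact_locus (Alexandroff_noodles X)"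
  shows "h (noodle x 0) = noodle y 0"
proof -
  have "h (noodle x 0) \<in> strand y"
    using Homeo_image_strand[OF t1 h xy end_in] by force
  moreover have "h (noodle x 0) \<notin> compact_locus (Alexandroff_noodles X)"
    using x0 Homeo_compact_locus_iff[OF h, of "noodle x 0"] xy(1) by simp
  ultimately show ?thesis
    using noodle_in_compact_locus_iff[OF t1 xy(2)] by (auto simp: strand_def)
qed

section \<open>A homeomorphism along one noodle, as a function on the unit interval\<close>

locale noodle_homeo =
  fixes X :: "'a topology" and h x y
  assumes t1: "t1_space X" and h: "h \<in> Homeo (Alexandroff_noodles X)"
    and x: "x \<in> topspace X" and y: "y \<in> topspace X" and end_in: "h (noodle x 1) \<in> arm X y"
begin

abbreviation Z where "Z \<equiv> Alexandroff_noodles X"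

definition \<phi> :: "real \<Rightarrow> real" where
  "\<phi> u = coord y (h (noodle x u))"

lemma image_strand: "h ` strand x = strand y"
  by (rule Homeo_image_strand[OF t1 h x y end_in])

lemma apply_noodle:
  assumes "u \<in> {0..1}"
  shows "h (noodle x u) = noodle y (\<phi> u)" "\<phi> u \<in> {0..1}"
proof -
  have "h (noodle x u) \<in> h ` strand x"
    using assms by (simp add: strand_def)
  then obtain t where t: "h (noodle x u) = noodle y t" "t \<in> {0..1}"
    unfolding image_strand by (auto simp: strand_def)
  then have "\<phi> u = t" by (simp add: \<phi>_def)
  with t show "h (noodle x u) = noodle y (\<phi> u)" "\<phi> u \<in> {0..1}" by simp_all
qed

lemma continuous_on_\<phi>: "continuous_on {0..1} \<phi>"
proof -
  have "continuous_map Z Z h"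
    using h by (simp add: Homeo_def homeomorphic_imp_continuous_map)
  then have "continuous_map (top_of_set {0..1}) Z (h \<circ> noodle x)"
    by (rule continuous_map_compose[OF continuous_map_noodle[OF x]])
  then have "continuous_map (top_of_set {0..1}) euclideanreal (coord y \<circ> (h \<circ> noodle x))"
    by (rule continuous_map_compose[OF _ continuous_map_coord])
  moreover have "coord y \<circ> (h \<circ> noodle x) = \<phi>"
    by (simp add: fun_eq_iff \<phi>_def)
  ultimately show ?thesis by simp
qed

lemma inj_on_\<phi>: "inj_on \<phi> {0..1}"
proof (rule inj_onI)
  fix u v assume uv: "u \<in> {0..1}" "v \<in> {0..1}" "\<phi> u = \<phi> v"
  then have "h (noodle x u) = h (noodle x v)"
    using apply_noodle(1)[of u] apply_noodle(1)[of v] by metis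
  moreover have "inj_on h (topspace Z)"
    using Homeo_bij_betw[OF h] by (simp add: bij_betw_def)
  ultimately have "noodle x u = noodle x v"
    using uv x by (auto dest: inj_onD)
  then show "u = v" by simp
qed

text \<open>A continuous injective function on an interval is strictly monotone, so the value at
  \<open>u\<close> lies between those at \<open>a\<close> and \<open>b\<close>.\<close>

lemma \<phi>_between:
  assumes "{a..b} \<subseteq> {0..1}" "u \<in> {a..b}" "\<phi> a \<in> J" "\<phi> b \<in> J" "is_interval J"
  shows "\<phi> u \<in> J"
proof (cases "u = a \<or> u = b")
  case False
  then have "a < u" "u < b" using assms(2) by auto
  then have "(\<phi> a < \<phi> u \<and> \<phi> u < \<phi> b) \<or> (\<phi> b < \<phi> u \<and> \<phi> u < \<phi> a)"
    by (rule continuous_inj_imp_mono)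
       (use assms(1) continuous_on_\<phi> inj_on_\<phi> continuous_on_subset inj_on_subset in blast)+
  then show ?thesis
    using assms(3-5) unfolding is_interval_1 by (meson less_imp_le)
qed (use assms in auto)

text \<open>The arm of \<open>y\<close> is open, so evaluation at the free end alone fixes the
  target noodle for all nearby homeomorphisms.\<close>

lemma eventually_noodle_homeo:
  "\<forall>\<^sub>F f in near Z h. noodle_homeo X f x y"
proof -
  have "\<forall>\<^sub>F f in near Z h. f (noodle x 1) \<in> arm X y"
    using x by (intro eventually_near_eval h openin_arm t1 y end_in) simp
  moreover have "\<forall>\<^sub>F f in near Z h. f \<in> Homeo Z"
    by (rule eventually_near_Homeo[OF h])
  ultimately show ?thesis
    by eventually_elim (simp add: noodle_homeo_def t1 x y)
qed

text \<open>Pointwise closeness at \<open>a\<close> and \<open>b\<close> suffices: the coordinate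
  function of each nearby \<open>f\<close> is monotone too, so its values on the whole interval are
  caught between two values in \<open>J\<close>.\<close>

lemma eventually_\<phi>_in_interval:
  assumes ab: "{a..b} \<subseteq> {0..1}" "a \<le> b" and J: "open J" "is_interval J" "\<phi> a \<in> J" "\<phi> b \<in> J"
  shows "\<forall>\<^sub>F f in near Z h. \<forall>u\<in>{a..b}. noodle_homeo.\<phi> f x y u \<in> J"
proof -
  \<comment> \<open>If \<open>J\<close> contains \<open>0\<close>, this set also contains points of
    other noodles. This is harmless, since only the coordinate is read off afterwards.\<close>
  let ?V = "{z \<in> topspace Z. coord y z \<in> J}"
  have V: "openin Z ?V"
    using continuous_map_coord[of X y] J(1) by (simp add: continuous_map_def)
  have *: "\<forall>\<^sub>F f in near Z h. f (noodle x u) \<in> ?V" if "u \<in> {a, b}" for u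
  proof (rule eventually_near_eval[OF h _ V])
    show "noodle x u \<in> topspace Z" using that ab x by auto
    then show "h (noodle x u) \<in> ?V"
      using that J Homeo_in_topspace[OF h] by (auto simp: \<phi>_def)
  qed
  have "\<forall>\<^sub>F f in near Z h. f (noodle x a) \<in> ?V" "\<forall>\<^sub>F f in near Z h. f (noodle x b) \<in> ?V"
    using * by simp_all
  then show ?thesis
    using eventually_noodle_homeo
  proof eventually_elim
    case (elim f)
    interpret f: noodle_homeo X f x y by (rule elim(3))
    have "f.\<phi> a \<in> J" "f.\<phi> b \<in> J" using elim(1,2) by (simp_all add: f.\<phi>_def)
    then show ?case using f.\<phi>_between[OF ab(1)] J(2) by blast
  qed
qed

text \<open>By injectivity \<open>\<phi> s\<close> misses the connected image of the interval, so
  \<open>\<phi> a\<close> and \<open>\<phi> b\<close> lie strictly on the same side of it. The open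
  half-line on that side serves as \<open>J\<close>. An empty interval is trivial.\<close>

lemma eventually_\<phi>_avoids:
  assumes ab: "{a..b} \<subseteq> {0..1}" and s: "s \<in> {0..1}" "s \<notin> {a..b}"
  shows "\<forall>\<^sub>F f in near Z h. \<forall>u\<in>{a..b}. noodle_homeo.\<phi> f x y u \<noteq> \<phi> s"
proof (cases "a \<le> b")
  case True
  have "\<phi> s \<notin> \<phi> ` {a..b}"
    using inj_on_image_mem_iff[OF inj_on_\<phi> s(1) ab] s(2) by simp
  moreover have conn: "connected (\<phi> ` {a..b})"
    using continuous_on_subset[OF continuous_on_\<phi> ab] by (rule connected_continuous_image) simp
  moreover have ends: "\<phi> a \<in> \<phi> ` {a..b}" "\<phi> b \<in> \<phi> ` {a..b}" using True by auto
  ultimately have "\<not> (\<phi> a \<le> \<phi> s \<and> \<phi> s \<le> \<phi> b)" "\<not> (\<phi> b \<le> \<phi> s \<and> \<phi> s \<le> \<phi> a)"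
    using connectedD_interval[OF conn ends] connectedD_interval[OF conn ends(2,1)] by blast+
  then consider "\<phi> a < \<phi> s" "\<phi> b < \<phi> s" | "\<phi> s < \<phi> a" "\<phi> s < \<phi> b"
    by linarith
  then obtain J where "open J" "is_interval J" "\<phi> a \<in> J" "\<phi> b \<in> J" "\<phi> s \<notin> J"
  proof cases
    case 1
    then show ?thesis using that[of "{..<\<phi> s}"] by (simp add: is_interval_1)
  next
    case 2
    then show ?thesis using that[of "{\<phi> s<..}"] by (simp add: is_interval_1)
  qed
  then show ?thesis
    using eventually_\<phi>_in_interval[OF ab True, of J] by (auto elim!: eventually_mono)
qed simp

text \<open>Continuity of \<open>\<phi>\<close> gives an interval around \<open>s\<close> whose end
  points are mapped into a small \<open>J\<close>; every nearby \<open>f\<close> then maps the whole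
  interval into \<open>J\<close>.\<close>

lemma equicontinuous_at:
  assumes s: "noodle x s \<in> arm X x" and V: "openin Z V" "h (noodle x s) \<in> V"
  shows "\<exists>W. openin Z W \<and> noodle x s \<in> W \<and> (\<forall>\<^sub>F f in near Z h. f ` W \<subseteq> V)"
proof -
  have s01: "s \<in> {0..1}" using s by (simp add: arm_def)
  have "openin (top_of_set {0..1}) {t \<in> {0..1}. noodle y t \<in> V}" "\<phi> s \<in> {t \<in> {0..1}. noodle y t \<in> V}"
    using V y apply_noodle[OF s01] by (auto simp: openin_Alexandroff_noodles)
  then obtain d where d: "d > 0" "\<And>t. t \<in> {0..1} \<Longrightarrow> \<bar>t - \<phi> s\<bar> < d \<Longrightarrow> t \<in> {t \<in> {0..1}. noodle y t \<in> V}"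
    using openin_unit_interval_ball by blast
  define J where "J = {\<phi> s - d <..< \<phi> s + d}"
  have J: "open J" "is_interval J" "\<phi> s \<in> J"
    using \<open>d > 0\<close> by (auto simp: J_def is_interval_1)
  have "openin (top_of_set {0..1}) ({0..1} \<inter> \<phi> -` J)"
    using continuous_on_\<phi> J(1) by (rule continuous_openin_preimage_gen)
  then obtain e where e: "e > 0" "\<And>u. u \<in> {0..1} \<Longrightarrow> \<bar>u - s\<bar> < e \<Longrightarrow> u \<in> {0..1} \<inter> \<phi> -` J"
    using openin_unit_interval_ball[of _ s] s01 J(3) by blast
  \<comment> \<open>Half of \<open>e\<close> puts both end points strictly within distance
    \<open>e\<close> of \<open>s\<close>; clipping keeps them in the unit interval.\<close>
  define a b where "a = max 0 (s - e / 2)" and "b = min 1 (s + e / 2)"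
  have ab: "{a..b} \<subseteq> {0..1}" "a \<le> b" "\<phi> a \<in> J" "\<phi> b \<in> J"
    using s01 \<open>e > 0\<close> e(2)[of a] e(2)[of b] by (auto simp: a_def b_def max_def min_def)
  \<comment> \<open>The arm is needed as a factor: \<open>coord x\<close> vanishes on all other
    noodles, so for small \<open>s\<close> the condition on it would admit their points.\<close>
  define W where "W = arm X x \<inter> {z \<in> topspace Z. coord x z \<in> {s - e / 2 <..< s + e / 2}}"
  have "openin Z {z \<in> topspace Z. coord x z \<in> {s - e / 2 <..< s + e / 2}}"
    using continuous_map_coord[of X x] unfolding continuous_map_def by (simp del: greaterThanLessThan_iff)
  then have "openin Z W"
    unfolding W_def by (rule openin_Int[OF openin_arm[OF t1 x]])
  moreover have "noodle x s \<in> W"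
    using s s01 x \<open>e > 0\<close> by (simp add: W_def)
  moreover have "\<forall>\<^sub>F f in near Z h. f ` W \<subseteq> V"
    using eventually_\<phi>_in_interval[OF ab(1,2) J(1,2) ab(3,4)] eventually_noodle_homeo
  proof eventually_elim
    case (elim f)
    interpret f: noodle_homeo X f x y by (rule elim(2))
    show ?case
    proof (rule image_subsetI)
      fix w assume w: "w \<in> W"
      then obtain u where u: "w = noodle x u" "u \<in> {0..1}"
        by (auto simp: W_def arm_def strand_def)
      then have "u \<in> {a..b}" using w by (auto simp: W_def a_def b_def)
      then have "f.\<phi> u \<in> J" using elim(1) by blast
      then have "\<bar>f.\<phi> u - \<phi> s\<bar> < d" by (auto simp: J_def)
      then have "noodle y (f.\<phi> u) \<in> V" using d(2) f.apply_noodle(2)[OF u(2)] by blast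
      then show "f w \<in> V" using f.apply_noodle(1)[OF u(2)] u(1) by simp
    qed
  qed
  ultimately show ?thesis by blast
qed

text \<open>A nearby \<open>f\<close> maps the noodle of \<open>x\<close> onto the same noodle as
  \<open>h\<close> does, so it attains the value somewhere. It avoids that value at all heights at
  least \<open>d / 2\<close> away from \<open>s\<close>, hence attains it at a height where the
  noodle lies in \<open>V\<close>.\<close>

lemma eventually_in_image:
  assumes s: "s \<in> {0..1}" and V: "openin Z V" "noodle x s \<in> V"
  shows "\<forall>\<^sub>F f in near Z h. h (noodle x s) \<in> f ` V"
proof -
  have "openin (top_of_set {0..1}) {t \<in> {0..1}. noodle x t \<in> V}" "s \<in> {t \<in> {0..1}. noodle x t \<in> V}"
    using V x s by (auto simp: openin_Alexandroff_noodles)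
  then obtain d where d: "d > 0" "\<And>t. t \<in> {0..1} \<Longrightarrow> \<bar>t - s\<bar> < d \<Longrightarrow> t \<in> {t \<in> {0..1}. noodle x t \<in> V}"
    using openin_unit_interval_ball by blast
  have "\<forall>\<^sub>F f in near Z h. \<forall>u\<in>{0..s - d / 2}. noodle_homeo.\<phi> f x y u \<noteq> \<phi> s"
    using s \<open>d > 0\<close> by (intro eventually_\<phi>_avoids) auto
  moreover have "\<forall>\<^sub>F f in near Z h. \<forall>u\<in>{s + d / 2..1}. noodle_homeo.\<phi> f x y u \<noteq> \<phi> s"
    using s \<open>d > 0\<close> by (intro eventually_\<phi>_avoids) auto
  ultimately show ?thesis
    using eventually_noodle_homeo
  proof eventually_elim
    case (elim f)
    interpret f: noodle_homeo X f x y by (rule elim(3))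
    have "h (noodle x s) \<in> f ` strand x"
      using apply_noodle[OF s] f.image_strand by simp
    then obtain c where c: "c \<in> {0..1}" "h (noodle x s) = f (noodle x c)"
      by (auto simp: strand_def)
    then have "f.\<phi> c = \<phi> s" by (simp add: \<phi>_def f.\<phi>_def)
    then have "c \<notin> {0..s - d / 2}" "c \<notin> {s + d / 2..1}" using elim(1,2) by auto
    then have "\<bar>c - s\<bar> < d" using c(1) \<open>d > 0\<close> by auto
    then have "noodle x c \<in> V" using d(2) c(1) by blast
    then show ?case using c(2) by blast
  qed
qed

end

theorem corollary3p3:
  fixes X :: "'a topology"
  assumes "Tychonoff_space X"
  shows "topological_group (Homeo_group (Alexandroff_noodles X))
           (Homeo_pointwise (Alexandroff_noodles X))"
proof -
  let ?Z = "Alexandroff_noodles X"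
  have t1: "t1_space X" using assms by (simp add: Tychonoff_space_def)
  \<comment> \<open>Every point lies on some noodle, and the image of the free end selects the
    target, so the one-noodle analysis applies at each point.\<close>
  have point: "\<exists>x t y. z = noodle x t \<and> t \<in> {0..1} \<and> noodle_homeo X h x y"
    if h: "h \<in> Homeo ?Z" and z: "z \<in> topspace ?Z" for h z
  proof -
    obtain x t where x: "z = noodle x t" "x \<in> topspace X" "t \<in> {0..1}"
      using z by (auto simp: topspace_Alexandroff_noodles)
    moreover obtain y where "y \<in> topspace X" "h (noodle x 1) \<in> arm X y"
      using Homeo_noodle_end[OF t1 h x(2)] .
    ultimately show ?thesis
      using t1 h unfolding noodle_homeo_def by blast
  qed
  show ?thesis
  proof (rule topological_group_Homeo[where L = "compact_locus ?Z"])
    fix h z assume h: "h \<in> Homeo ?Z" and z: "z \<in> topspace ?Z - compact_locus ?Z"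
    then obtain x t y where xt: "z = noodle x t" "t \<in> {0..1}" and "noodle_homeo X h x y"
      using point by blast
    interpret noodle_homeo X h x y by fact
    have t: "t = 0" using z xt noodle_in_compact_locus_iff[OF t1 x] by auto
    \<comment> \<open>The value depends only on \<open>y\<close>, which all homeomorphisms near
      \<open>h\<close> share with \<open>h\<close>; this gives rigidity.\<close>
    have base: "f z = noodle y 0" if "noodle_homeo X f x y" for f
    proof -
      interpret f: noodle_homeo X f x y by fact
      show ?thesis using Homeo_noodle_base[OF t1 f.h x y f.end_in] z xt t by simp
    qed
    show "\<forall>\<^sub>F f in near ?Z h. f z = h z"
      using eventually_noodle_homeo
      by eventually_elim (simp add: base noodle_homeo_axioms)
  next
    fix h z V
    assume h: "h \<in> Homeo ?Z" and z: "z \<in> topspace ?Z \<inter> compact_locus ?Z" and V: "openin ?Z V" "h z \<in> V"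
    then obtain x t y where xt: "z = noodle x t" "t \<in> {0..1}" and "noodle_homeo X h x y"
      using point by blast
    then show "\<exists>W. openin ?Z W \<and> z \<in> W \<and> (\<forall>\<^sub>F f in near ?Z h. f ` W \<subseteq> V)"
      using noodle_homeo.equicontinuous_at[of X h x y t V] z V by (simp add: arm_def)
  next
    fix h z V
    assume h: "h \<in> Homeo ?Z" and z: "z \<in> topspace ?Z \<inter> compact_locus ?Z" and V: "openin ?Z V" "z \<in> V"
    then obtain x t y where xt: "z = noodle x t" "t \<in> {0..1}" and "noodle_homeo X h x y"
      using point by blast
    then show "\<forall>\<^sub>F f in near ?Z h. h z \<in> f ` V"
      using noodle_homeo.eventually_in_image[of X h x y t V] V by simp
  qed (rule Homeo_compact_locus_iff)
qed

end
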